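(* Let $G = G_2(2,\beta,1,0,-)$ be a metacyclic $2$-group of negative type (with $\alpha=2$, $\epsilon=1$, $\delta=0$), where $\beta\ge 3$. Then $\eta(G)=\beta+2$.
   Context: For a finite group $G$, a maximal cyclic subgroup is a cyclic subgroup not properly contained in any other cyclic subgroup, and $\eta(G)$ is the number of conjugacy classes of maximal cyclic subgroups of $G$. Write $x^y = y^{-1}xy$. For integers $\alpha,\beta>0$, $\delta\ge 0$, $\epsilon\in\{0,1\}$ with $\delta\le\beta$, $\alpha-\delta\ge 2$ and $\delta+\epsilon\le\alpha$ (and $\beta\ge\delta+1$ when $\epsilon=1$), the metacyclic $2$-group of negative type is $$G_2(\alpha,\beta,\epsilon,\delta,-)=\langle x,y \mid x^{2^\alpha}=1,\ y^{2^\beta}=x^{2^{\alpha-\epsilon}},\ x^y=x^{r}\rangle,\quad r=2^{\alpha-\delta}-1.$$ It has order $2^{\alpha+\beta}$. *)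

theory Defs
  imports "HOL-Algebra.Algebra"
begin

section \<open>Conjugacy classes of maximal cyclic subgroups\<close>

definition cyclic_subgroup :: "('a, 'b) monoid_scheme \<Rightarrow> 'a set \<Rightarrow> bool" where
  "cyclic_subgroup G C \<longleftrightarrow> (\<exists>g\<in>carrier G. C = generate G {g})"

definition maximal_cyclic_subgroup :: "('a, 'b) monoid_scheme \<Rightarrow> 'a set \<Rightarrow> bool" where
  "maximal_cyclic_subgroup G C \<longleftrightarrow>
     cyclic_subgroup G C \<and> \<not> (\<exists>D. cyclic_subgroup G D \<and> C \<subset> D)"

definition subgroup_conj_class :: "('a, 'b) monoid_scheme \<Rightarrow> 'a set \<Rightarrow> 'a set set" where
  "subgroup_conj_class G H = {(inv\<^bsub>G\<^esub> g <#\<^bsub>G\<^esub> H) #>\<^bsub>G\<^esub> g | g. g \<in> carrier G}"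

text \<open>Only meaningful for finite \<open>G\<close>, since \<open>card\<close> of an infinite set is \<open>0\<close>.\<close>

definition eta :: "('a, 'b) monoid_scheme \<Rightarrow> nat" where
  "eta G = card (subgroup_conj_class G ` {C. maximal_cyclic_subgroup G C})"


section \<open>Groups given by generators and relations\<close>

text \<open>
  A letter \<open>(False, a)\<close> is the generator \<open>a\<close>, and \<open>(True, a)\<close> is its formal inverse.
  All elements of the type \<open>'a\<close> are generators.
\<close>

type_synonym 'a gword = "(bool \<times> 'a) list"

definition gw :: "'a \<Rightarrow> 'a gword" where
  "gw a = [(False, a)]"

definition gw_inv :: "'a gword \<Rightarrow> 'a gword" where
  "gw_inv w = rev (map (\<lambda>(s, a). (\<not> s, a)) w)"

definition gw_pow :: "'a gword \<Rightarrow> nat \<Rightarrow> 'a gword" where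
  "gw_pow w n = concat (replicate n w)"

text \<open>
  The least congruence on words that identifies \<open>a a\<^sup>-\<^sup>1\<close> and \<open>a\<^sup>-\<^sup>1 a\<close> with the empty word
  and the two sides of every relation in \<open>R\<close>.
\<close>

inductive pres_eq :: "('a gword \<times> 'a gword) set \<Rightarrow> 'a gword \<Rightarrow> 'a gword \<Rightarrow> bool"
  for R :: "('a gword \<times> 'a gword) set" where
  refl: "pres_eq R w w"
| sym: "pres_eq R v w \<Longrightarrow> pres_eq R w v"
| trans: "pres_eq R u v \<Longrightarrow> pres_eq R v w \<Longrightarrow> pres_eq R u w"
| cancel: "pres_eq R (u @ [(s, a), (\<not> s, a)] @ v) (u @ v)"
| rel: "(l, r) \<in> R \<Longrightarrow> pres_eq R (u @ l @ v) (u @ r @ v)"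

definition pres_rel :: "('a gword \<times> 'a gword) set \<Rightarrow> ('a gword \<times> 'a gword) set" where
  "pres_rel R = {(v, w). pres_eq R v w}"

definition presented_group :: "('a gword \<times> 'a gword) set \<Rightarrow> 'a gword set monoid" where
  "presented_group R =
     \<lparr>carrier = UNIV // pres_rel R,
      monoid.mult = (\<lambda>A B. \<Union>u\<in>A. \<Union>v\<in>B. pres_rel R `` {u @ v}),
      one = pres_rel R `` {[]}\<rparr>"

lemma equiv_pres_rel: "equiv UNIV (pres_rel R)"
  by (rule equivI) (auto simp: pres_rel_def refl_on_def sym_def trans_def
      intro: pres_eq.refl pres_eq.sym pres_eq.trans)

lemma pres_eq_context: "pres_eq R v w \<Longrightarrow> pres_eq R (p @ v @ q) (p @ w @ q)"
proof (induction rule: pres_eq.induct)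
  case (cancel u s a v)
  show ?case using pres_eq.cancel[of R "p @ u" s a "v @ q"] by simp
next
  case (rel l r u v)
  then show ?case using pres_eq.rel[of l r R "p @ u" "v @ q"] by simp
qed (blast intro: pres_eq.refl pres_eq.sym pres_eq.trans)+

lemma pres_eq_append:
  assumes "pres_eq R u u'" "pres_eq R v v'"
  shows "pres_eq R (u @ v) (u' @ v')"
  using pres_eq_context[OF assms(1), of "[]" v] pres_eq_context[OF assms(2), of u' "[]"]
  by (auto intro: pres_eq.trans)

lemma presented_group_mult:
  "(pres_rel R `` {u}) \<otimes>\<^bsub>presented_group R\<^esub> (pres_rel R `` {v}) = pres_rel R `` {u @ v}"
proof -
  have "congruent2 (pres_rel R) (pres_rel R) (\<lambda>u v. pres_rel R `` {u @ v})"
    unfolding congruent2_def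
    using pres_eq_append equiv_class_eq[OF equiv_pres_rel] by (fastforce simp: pres_rel_def)
  then show ?thesis
    unfolding presented_group_def
    using UN_equiv_class2[OF equiv_pres_rel equiv_pres_rel] by simp
qed

lemma pres_eq_inv: "pres_eq R (gw_inv w @ w) []"
proof (induction w)
  case Nil
  show ?case by (simp add: gw_inv_def pres_eq.refl)
next
  case (Cons l w)
  obtain s a where l: "l = (s, a)" by (cases l)
  have "pres_eq R (gw_inv w @ [(\<not> s, a), (\<not> \<not> s, a)] @ w) (gw_inv w @ w)"
    by (rule pres_eq.cancel)
  then show ?case using Cons pres_eq.trans by (fastforce simp: gw_inv_def l)
qed

lemma group_presented_group: "group (presented_group R)"
proof (rule groupI)
  let ?P = "presented_group R"
  have carr: "carrier ?P = range (\<lambda>w. pres_rel R `` {w})"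
    by (auto simp: presented_group_def quotient_def)
  have one: "\<one>\<^bsub>?P\<^esub> = pres_rel R `` {[]}"
    by (simp add: presented_group_def)
  show "\<one>\<^bsub>?P\<^esub> \<in> carrier ?P" by (simp add: carr one)
  fix A assume "A \<in> carrier ?P"
  then obtain u where A: "A = pres_rel R `` {u}" by (auto simp: carr)
  show "\<one>\<^bsub>?P\<^esub> \<otimes>\<^bsub>?P\<^esub> A = A" by (simp add: A one presented_group_mult)
  have "pres_rel R `` {gw_inv u @ u} = pres_rel R `` {[]}"
    by (rule equiv_class_eq[OF equiv_pres_rel]) (simp add: pres_rel_def pres_eq_inv)
  then show "\<exists>B\<in>carrier ?P. B \<otimes>\<^bsub>?P\<^esub> A = \<one>\<^bsub>?P\<^esub>"
    by (auto simp: A carr one presented_group_mult)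
  fix B assume "B \<in> carrier ?P"
  then obtain v where B: "B = pres_rel R `` {v}" by (auto simp: carr)
  show "A \<otimes>\<^bsub>?P\<^esub> B \<in> carrier ?P" by (simp add: A B carr presented_group_mult)
  fix C assume "C \<in> carrier ?P"
  then obtain w where C: "C = pres_rel R `` {w}" by (auto simp: carr)
  show "A \<otimes>\<^bsub>?P\<^esub> B \<otimes>\<^bsub>?P\<^esub> C = A \<otimes>\<^bsub>?P\<^esub> (B \<otimes>\<^bsub>?P\<^esub> C)"
    by (simp add: A B C presented_group_mult)
qed


section \<open>Metacyclic 2-groups of negative type\<close>

datatype gen = gen_x | gen_y

text \<open>
  The relations are \<open>x^(2^\<alpha>) = 1\<close>, \<open>y^(2^\<beta>) = x^(2^(\<alpha>-\<epsilon>))\<close> and \<open>y\<^sup>-\<^sup>1 x y = x^r\<close> with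
  \<open>r = 2^(\<alpha>-\<delta>) - 1\<close>.  The subtractions are on \<open>nat\<close>; the intended parameters satisfy
  \<open>\<alpha>, \<beta> > 0\<close>, \<open>\<epsilon> \<le> 1\<close>, \<open>\<delta> \<le> \<beta>\<close>, \<open>\<alpha> \<ge> \<delta> + 2\<close>, \<open>\<delta> + \<epsilon> \<le> \<alpha>\<close>, and \<open>\<beta> \<ge> \<delta> + 1\<close> if
  \<open>\<epsilon> = 1\<close>, so that none of them truncates.
\<close>

definition G2_neg_rels :: "nat \<Rightarrow> nat \<Rightarrow> nat \<Rightarrow> nat \<Rightarrow> (gen gword \<times> gen gword) set" where
  "G2_neg_rels \<alpha> \<beta> \<epsilon> \<delta> =
     {(gw_pow (gw gen_x) (2 ^ \<alpha>), []),
      (gw_pow (gw gen_y) (2 ^ \<beta>), gw_pow (gw gen_x) (2 ^ (\<alpha> - \<epsilon>))),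
      (gw_inv (gw gen_y) @ gw gen_x @ gw gen_y, gw_pow (gw gen_x) (2 ^ (\<alpha> - \<delta>) - 1))}"

definition G2_neg :: "nat \<Rightarrow> nat \<Rightarrow> nat \<Rightarrow> nat \<Rightarrow> gen gword set monoid" where
  "G2_neg \<alpha> \<beta> \<epsilon> \<delta> = presented_group (G2_neg_rels \<alpha> \<beta> \<epsilon> \<delta>)"

end

theory Submission
  imports Defs
begin

text \<open>
  Write \<open>n = 2^\<beta>\<close> and \<open>t = y^(-n/2) x\<close>.  The relation \<open>y\<^sup>-\<^sup>1 x y = x\<^sup>3\<close>
  reads \<open>x y = y x\<^sup>2 x = y^(1+n) x\<close>, since \<open>x\<^sup>2 = y^n\<close>.  Hence \<open>t\<^sup>2 = 1\<close> and \<open>t y = y^(1+n) t\<close>,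
  so the group is the modular maximal-cyclic group of order \<open>4n\<close>: every element is \<open>y^i t^a\<close>
  with \<open>i\<close> an integer modulo \<open>2n\<close> and \<open>a\<close> a truth value.  The locale \<open>twisted_coordinates\<close>
  records exactly this description, and \<open>\<eta>\<close> is computed from it.

  No generator of \<open>\<langle>y\<rangle>\<close> is a power of some \<open>y^i t\<close>, because the powers of \<open>y^i t\<close> that lie in
  \<open>\<langle>y\<rangle>\<close> are even powers of \<open>y\<close>; so \<open>\<langle>y\<rangle>\<close> is maximal cyclic.  An element \<open>y^i t\<close> can only be an odd
  power of an element \<open>y^j t\<close>, which then generates the same subgroup because the group is a
  2-group; so every \<open>\<langle>y^i t\<rangle>\<close> is maximal cyclic.  It remains to count the subgroups \<open>\<langle>y^i t\<rangle>\<close> up to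
  conjugacy.  Conjugation by \<open>y\<close> sends \<open>y^i t\<close> to \<open>y^(i+n) t\<close>, so only \<open>i\<close> modulo \<open>n\<close> matters,
  and modulo \<open>n\<close> an odd power \<open>m\<close> multiplies \<open>i\<close> by \<open>m\<close>.  The classes therefore correspond to the
  orbits of odd multipliers on the integers modulo \<open>n\<close>, which are represented by \<open>2^k\<close> for
  \<open>k \<le> \<beta>\<close>.  With the class of \<open>\<langle>y\<rangle>\<close> this makes \<open>\<beta> + 2\<close>.

  That the coordinates do not collapse in the group given by the presentation is seen by letting
  words act on pairs \<open>(i, a)\<close> as right multiplication acts on \<open>y^i t^a\<close>: words equal in the group act
  in the same way modulo \<open>2n\<close>, and the pair reached from \<open>(0, False)\<close> recovers the coordinates.
\<close>

section \<open>Conjugation and cyclic subgroups\<close>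

context group
begin

lemma conj_hom:
  assumes "g \<in> carrier G"
  shows "group_hom G G (\<lambda>a. inv g \<otimes> a \<otimes> g)"
proof unfold_locales
  show "(\<lambda>a. inv g \<otimes> a \<otimes> g) \<in> hom G G"
  proof (rule homI)
    fix a b assume "a \<in> carrier G" "b \<in> carrier G"
    moreover have "g \<otimes> (inv g \<otimes> c) = c" if "c \<in> carrier G" for c
      using assms that by (simp flip: m_assoc)
    ultimately show "inv g \<otimes> (a \<otimes> b) \<otimes> g = inv g \<otimes> a \<otimes> g \<otimes> (inv g \<otimes> b \<otimes> g)"
      using assms by (simp add: m_assoc)
  qed (use assms in simp)
qed

lemma int_pow_conj:
  assumes "g \<in> carrier G" "a \<in> carrier G"
  shows "(inv g \<otimes> a \<otimes> g) [^] (k::int) = inv g \<otimes> a [^] k \<otimes> g"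
  using group_hom.hom_int_pow[OF conj_hom[OF assms(1)] assms(2)] by simp

lemma coset_conj_eq_image:
  "(inv g <# H) #> g = (\<lambda>a. inv g \<otimes> a \<otimes> g) ` H"
  by (auto simp: l_coset_def r_coset_def)

lemma conj_generate:
  assumes "g \<in> carrier G" "a \<in> carrier G"
  shows "(inv g <# generate G {a}) #> g = generate G {inv g \<otimes> a \<otimes> g}"
  using group_hom.generate_img[OF conj_hom[OF assms(1)], of "{a}"] assms
  by (simp add: coset_conj_eq_image)

lemma subgroup_conj_class_generate:
  assumes "a \<in> carrier G"
  shows "subgroup_conj_class G (generate G {a}) =
    {generate G {inv g \<otimes> a \<otimes> g} | g. g \<in> carrier G}"
  unfolding subgroup_conj_class_def Setcompr_eq_image
  by (rule image_cong) (simp_all add: conj_generate assms)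

lemma subgroup_conj_class_conj:
  assumes a: "a \<in> carrier G" and k: "k \<in> carrier G"
  shows "subgroup_conj_class G (generate G {inv k \<otimes> a \<otimes> k}) =
    subgroup_conj_class G (generate G {a})"
proof -
  have comp: "inv g \<otimes> (inv k \<otimes> a \<otimes> k) \<otimes> g = inv (k \<otimes> g) \<otimes> a \<otimes> (k \<otimes> g)"
    if "g \<in> carrier G" for g
    using a k that by (simp add: m_assoc inv_mult_group)
  have onto: "\<exists>g'\<in>carrier G. g = k \<otimes> g'" if "g \<in> carrier G" for g
    using k that by (intro bexI[of _ "inv k \<otimes> g"]) (simp_all flip: m_assoc)
  have "{generate G {inv g \<otimes> (inv k \<otimes> a \<otimes> k) \<otimes> g} | g. g \<in> carrier G} =
      {generate G {inv g \<otimes> a \<otimes> g} | g. g \<in> carrier G}"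
  proof (intro equalityI subsetI)
    fix C assume "C \<in> {generate G {inv g \<otimes> (inv k \<otimes> a \<otimes> k) \<otimes> g} | g. g \<in> carrier G}"
    then obtain g where "g \<in> carrier G" "C = generate G {inv g \<otimes> (inv k \<otimes> a \<otimes> k) \<otimes> g}"
      by blast
    then show "C \<in> {generate G {inv g \<otimes> a \<otimes> g} | g. g \<in> carrier G}"
      using comp m_closed[OF k] by auto
  next
    fix C assume "C \<in> {generate G {inv g \<otimes> a \<otimes> g} | g. g \<in> carrier G}"
    then obtain g where g: "g \<in> carrier G" "C = generate G {inv g \<otimes> a \<otimes> g}"
      by blast
    obtain g' where "g' \<in> carrier G" "g = k \<otimes> g'"
      using onto[OF g(1)] by blast
    then show "C \<in> {generate G {inv g \<otimes> (inv k \<otimes> a \<otimes> k) \<otimes> g} | g. g \<in> carrier G}"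
      using comp[of g'] g(2) by (intro CollectI exI[of _ g']) simp
  qed
  then show ?thesis
    by (simp only: subgroup_conj_class_generate[OF a]
        subgroup_conj_class_generate[OF m_closed[OF m_closed[OF inv_closed[OF k] a] k]])
qed

text \<open>
  Equality of classes of cyclic subgroups is turned into one equation between elements; this is
  the form in which coordinates can separate classes.
\<close>

lemma power_conj_of_same_class:
  assumes a: "a \<in> carrier G" and b: "b \<in> carrier G"
    and eq: "subgroup_conj_class G (generate G {a}) = subgroup_conj_class G (generate G {b})"
  obtains g m where "g \<in> carrier G" "b = (inv g \<otimes> a \<otimes> g) [^] (m::int)"
proof -
  have "generate G {b} \<in> subgroup_conj_class G (generate G {b})"
    unfolding subgroup_conj_class_generate[OF b] using b by force
  then obtain g where g: "g \<in> carrier G" "generate G {b} = generate G {inv g \<otimes> a \<otimes> g}"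
    unfolding eq[symmetric] subgroup_conj_class_generate[OF a] by auto
  have "b \<in> generate G {inv g \<otimes> a \<otimes> g}"
    using g(2) generate.incl[of b "{b}" G] by simp
  then obtain m where "b = (inv g \<otimes> a \<otimes> g) [^] (m::int)"
    using generate_pow[of "inv g \<otimes> a \<otimes> g"] g(1) a by auto
  then show thesis
    by (rule that[OF g(1)])
qed

lemma generate_subset_iff_power:
  assumes "a \<in> carrier G" "b \<in> carrier G"
  shows "generate G {a} \<subseteq> generate G {b} \<longleftrightarrow> (\<exists>m::int. a = b [^] m)"
proof
  assume "generate G {a} \<subseteq> generate G {b}"
  then show "\<exists>m::int. a = b [^] m"
    using generate.incl[of a "{a}" G] generate_pow[OF assms(2)] by auto
next
  assume "\<exists>m::int. a = b [^] m"
  then show "generate G {a} \<subseteq> generate G {b}"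
    using assms by (auto simp: generate_pow int_pow_pow)
qed

text \<open>
  Maximality of a cyclic subgroup in terms of roots of a generator: each element with \<open>a\<close> among its
  powers must itself be a power of \<open>a\<close>.
\<close>

lemma maximal_cyclic_generate_iff:
  assumes "a \<in> carrier G"
  shows "maximal_cyclic_subgroup G (generate G {a}) \<longleftrightarrow>
    (\<forall>b\<in>carrier G. (\<exists>m::int. a = b [^] m) \<longrightarrow> (\<exists>k::int. b = a [^] k))"
proof -
  have "maximal_cyclic_subgroup G (generate G {a}) \<longleftrightarrow>
      (\<forall>b\<in>carrier G. generate G {a} \<subseteq> generate G {b} \<longrightarrow> generate G {b} \<subseteq> generate G {a})"
    using assms unfolding maximal_cyclic_subgroup_def cyclic_subgroup_def psubset_eq by blast
  then show ?thesis
    by (simp only: generate_subset_iff_power assms cong: ball_cong)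
qed

text \<open>
  The relation says that conjugation by \<open>z\<close> maps \<open>y\<close> to \<open>y^c\<close>, and conjugation respects powers.
\<close>

lemma commute_int_pow:
  assumes y: "y \<in> carrier G" and z: "z \<in> carrier G" and rel: "z \<otimes> y = y [^] (c::int) \<otimes> z"
  shows "z \<otimes> y [^] (j::int) = y [^] (c * j) \<otimes> z"
proof -
  have "z \<otimes> y \<otimes> inv z = y [^] c"
    using y z rel by (simp add: m_assoc)
  then have "z \<otimes> y [^] j \<otimes> inv z = y [^] (c * j)"
    using int_pow_conj[of "inv z" y j] y z by (simp add: int_pow_pow)
  then show ?thesis
    using y z by (metis int_pow_closed inv_solve_right m_closed)
qed

end


section \<open>Twisted coordinates\<close>

text \<open>
  \<open>E i a\<close> stands for \<open>y^i t^a\<close>, where \<open>y\<close> has order \<open>2^(\<beta>+1)\<close>, \<open>t\<close> is an involution and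
  \<open>t y t = y^(1+2^\<beta>)\<close>.  The first coordinate is an arbitrary integer, so that products
  need no reduction and the order of \<open>y\<close> enters only through \<open>coord_eq_iff\<close>.
\<close>

locale twisted_coordinates = group G for G (structure) +
  fixes E :: "int \<Rightarrow> bool \<Rightarrow> 'a" and \<beta> :: nat
  assumes beta_pos: "\<beta> > 0"
    and carrier_coord: "carrier G = {E i a | i a. True}"
    and mult_coord:
      "E i a \<otimes> E j b = E (i + (if a then (1 + 2 ^ \<beta>) * j else j)) (a \<noteq> b)"
    and coord_eq_iff: "E i a = E j b \<longleftrightarrow> a = b \<and> 2 * 2 ^ \<beta> dvd i - j"
begin

lemma coord_closed [simp]: "E i a \<in> carrier G"
  using carrier_coord by auto

lemma one_coord: "\<one> = E 0 False"
proof -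
  have "E 0 False \<otimes> E 0 False = E 0 False"
    by (simp add: mult_coord)
  then show ?thesis
    using l_cancel_one by simp
qed

lemma untwisted_pow: "E i False [^] (k::int) = E (k * i) False"
proof -
  have nat: "E i False [^] (m::nat) = E (int m * i) False" for m
  proof (induction m)
    case 0
    show ?case by (simp add: one_coord)
  next
    case (Suc m)
    then show ?case by (simp add: mult_coord algebra_simps)
  qed
  show ?thesis
  proof (cases k rule: int_cases2)
    case (nonneg m)
    then show ?thesis using nat[of m] by (simp only: int_pow_int)
  next
    case (nonpos m)
    have "inv (E (int m * i) False) = E (- (int m * i)) False"
      by (rule inv_equality) (simp_all add: mult_coord one_coord)
    then show ?thesis
      using nat[of m] nonpos int_pow_neg_int[of "E i False" m] by simp
  qed
qed

text \<open>
  Because \<open>(y^i t)\<^sup>2 = y^i y^(i(1+2^\<beta>))\<close>, even powers leave the twisted half of the group.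
\<close>

lemma twisted_even_pow: "E i True [^] (2 * k :: int) = E (k * (i * (2 + 2 ^ \<beta>))) False"
proof -
  have "E i True [^] (2::int) = E i True \<otimes> E i True"
    using int_pow_mult[of "E i True" 1 1] by simp
  then have "E i True [^] (2::int) = E (i * (2 + 2 ^ \<beta>)) False"
    by (simp add: mult_coord algebra_simps)
  then show ?thesis
    using int_pow_pow[of "E i True" 2 k] by (simp add: untwisted_pow)
qed

lemma twisted_odd_pow:
  "E i True [^] (2 * k + 1 :: int) = E (i * (2 * k + 1) + 2 ^ \<beta> * (i * k)) True"
proof -
  have "E i True [^] (2 * k + 1) = E (k * (i * (2 + 2 ^ \<beta>))) False \<otimes> E i True"
    using twisted_even_pow[of i k] by (simp add: int_pow_mult)
  then show ?thesis
    by (simp add: mult_coord algebra_simps)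
qed

lemma even_pow_two: "even (2 ^ \<beta> :: int)"
  using beta_pos by simp

text \<open>
  The square of \<open>y^i t\<close> is an even power of \<open>y\<close>, and parity survives reduction modulo
  \<open>2^(\<beta>+1)\<close>.  This keeps \<open>y\<close> itself out of every \<open>\<langle>y^i t\<rangle>\<close>.
\<close>

lemma even_of_twisted_pow:
  assumes "E j False = E i True [^] (m::int)"
  shows "even j"
proof -
  have "even m"
  proof (rule ccontr)
    assume "odd m"
    then obtain k where "m = 2 * k + 1" by (auto elim: oddE)
    then show False using assms by (simp add: twisted_odd_pow coord_eq_iff)
  qed
  then obtain k where "m = 2 * k" by (auto elim: evenE)
  then have "2 * 2 ^ \<beta> dvd j - k * (i * (2 + 2 ^ \<beta>))"
    using assms by (simp add: twisted_even_pow coord_eq_iff)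
  then have "even (j - k * (i * (2 + 2 ^ \<beta>)))"
    by (rule dvd_trans[rotated]) simp
  then show ?thesis
    using even_pow_two by simp
qed

lemma odd_of_twisted_pow:
  assumes "E j True = E i True [^] (m::int)"
  obtains k where "m = 2 * k + 1" "2 * 2 ^ \<beta> dvd j - (i * m + 2 ^ \<beta> * (i * k))"
proof -
  have "odd m"
  proof
    assume "even m"
    then obtain k where "m = 2 * k" by (auto elim: evenE)
    then show False using assms by (simp add: twisted_even_pow coord_eq_iff)
  qed
  then obtain k where k: "m = 2 * k + 1" by (auto elim: oddE)
  then show thesis
    using that assms by (simp add: twisted_odd_pow coord_eq_iff)
qed

text \<open>
  The order of \<open>y^i t\<close> divides \<open>2^(\<beta>+2)\<close>, and an odd exponent is invertible modulo that number.
\<close>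

lemma twisted_pow_invertible:
  assumes "odd m"
  shows "\<exists>u::int. (E i True [^] (m::int)) [^] u = E i True"
proof -
  have "coprime m (2 ^ (\<beta> + 2))"
    using assms by (simp only: coprime_power_right_iff coprime_right_2_iff_odd) simp
  then obtain u c where "u * m + c * 2 ^ (\<beta> + 2) = 1"
    using bezout_int[of m "2 ^ (\<beta> + 2)"] by auto
  \<comment> \<open>The exponent \<open>m * u\<close> is put into the shape \<open>2 * k + 1\<close> with \<open>2^(\<beta>+1)\<close> dividing \<open>k\<close>.\<close>
  then have mu: "m * u = 2 * (- (c * (2 * 2 ^ \<beta>))) + 1"
    by (simp add: algebra_simps)
  have "E i True [^] (m * u) = E i True"
    unfolding mu twisted_odd_pow coord_eq_iff
    by (simp add: algebra_simps)
  then show ?thesis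
    by (auto simp: int_pow_pow)
qed

text \<open>
  A root of \<open>y^i t\<close> is again twisted, and the exponent is odd since even powers are untwisted;
  an odd power generates the same subgroup.
\<close>

lemma maximal_cyclic_twisted: "maximal_cyclic_subgroup G (generate G {E i True})"
  unfolding maximal_cyclic_generate_iff[OF coord_closed]
proof (intro ballI impI, elim exE)
  fix b m assume b: "b \<in> carrier G" and pow: "E i True = b [^] (m::int)"
  obtain j a where ja: "b = E j a"
    using b carrier_coord by auto
  have a
  proof (rule ccontr)
    assume "\<not> a"
    then show False
      using pow by (simp add: ja untwisted_pow coord_eq_iff)
  qed
  then have "odd m"
    using pow by (auto simp: ja elim: odd_of_twisted_pow)
  then obtain u :: int where "(E j True [^] m) [^] u = E j True"
    using twisted_pow_invertible by blast
  then have "b = E i True [^] u"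
    using \<open>a\<close> by (simp add: pow ja)
  then show "\<exists>k::int. b = E i True [^] k" ..
qed

lemma maximal_cyclic_untwisted: "maximal_cyclic_subgroup G (generate G {E 1 False})"
  unfolding maximal_cyclic_generate_iff[OF coord_closed]
proof (intro ballI impI, elim exE)
  fix b m assume b: "b \<in> carrier G" and pow: "E 1 False = b [^] (m::int)"
  obtain j a where ja: "b = E j a"
    using b carrier_coord by auto
  have "\<not> a"
    using pow even_of_twisted_pow[of 1 j m] ja by auto
  then show "\<exists>k::int. b = E 1 False [^] k"
    by (auto simp: ja untwisted_pow)
qed

lemma maximal_cyclic_cases:
  assumes "maximal_cyclic_subgroup G C"
  shows "C = generate G {E 1 False} \<or> (\<exists>i. C = generate G {E i True})"
proof -
  obtain i a where C: "C = generate G {E i a}"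
    using assms carrier_coord unfolding maximal_cyclic_subgroup_def cyclic_subgroup_def by auto
  show ?thesis
  proof (cases a)
    case False
    have "E i a = E 1 False [^] i"
      using False by (simp add: untwisted_pow)
    then have "C \<subseteq> generate G {E 1 False}"
      unfolding C by (intro generate_subset_iff_power[THEN iffD2] coord_closed exI)
    moreover have "\<not> C \<subset> generate G {E 1 False}"
      using assms coord_closed[of 1 False]
      unfolding maximal_cyclic_subgroup_def cyclic_subgroup_def by blast
    ultimately show ?thesis
      by blast
  qed (use C in auto)
qed

text \<open>
  The quotient by \<open>\<langle>y^(2^\<beta>)\<rangle>\<close> is abelian, so a conjugation moves the first coordinate by a multiple
  of \<open>2^\<beta>\<close> and fixes the second.
\<close>

lemma conj_coord:
  assumes "g \<in> carrier G"
  obtains i' where "inv g \<otimes> E i a \<otimes> g = E i' a" "2 ^ \<beta> dvd i' - i"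
proof -
  obtain j b where g: "g = E j b"
    using assms carrier_coord by auto
  obtain i' a' where c: "inv g \<otimes> E i a \<otimes> g = E i' a'"
    using assms carrier_coord m_closed[OF m_closed[OF inv_closed[OF assms] coord_closed] assms]
    by blast
  \<comment> \<open>Comparing both sides of this equation avoids coordinates for the inverse of \<open>g\<close>.\<close>
  have "g \<otimes> E i' a' = E i a \<otimes> g"
    unfolding c[symmetric] using assms by (simp flip: m_assoc)
  then have eq: "a' = a" and
    d: "2 * 2 ^ \<beta> dvd j + (if b then (1 + 2 ^ \<beta>) * i' else i') -
      (i + (if a then (1 + 2 ^ \<beta>) * j else j))"
    by (auto simp: g mult_coord coord_eq_iff)
  have "2 ^ \<beta> dvd j + (if b then (1 + 2 ^ \<beta>) * i' else i') -
      (i + (if a then (1 + 2 ^ \<beta>) * j else j))"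
    using d dvd_mult_right by blast
  moreover have "j + (if b then (1 + 2 ^ \<beta>) * i' else i') -
      (i + (if a then (1 + 2 ^ \<beta>) * j else j)) =
      (i' - i) + 2 ^ \<beta> * ((if b then i' else 0) - (if a then j else 0))"
    by (simp add: algebra_simps)
  ultimately have "2 ^ \<beta> dvd i' - i"
    by (metis dvd_add_left_iff dvd_triv_left)
  then show thesis
    using that c eq by simp
qed

text \<open>
  Conversely, conjugation by \<open>y^q\<close> adds \<open>2^\<beta> q\<close> to the first coordinate of \<open>y^i t\<close>.
\<close>

lemma same_class_of_cong:
  assumes "2 ^ \<beta> dvd i' - i"
  shows "subgroup_conj_class G (generate G {E i' True}) =
    subgroup_conj_class G (generate G {E i True})"
proof -
  obtain q where q: "i' = i + 2 ^ \<beta> * q"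
    using assms by (auto simp: algebra_simps elim!: dvdE)
  have "E (i + 2 ^ \<beta> * q) True = inv (E q False) \<otimes> E i True \<otimes> E q False"
  proof -
    have "E q False \<otimes> E (i + 2 ^ \<beta> * q) True = E i True \<otimes> E q False"
      by (simp add: mult_coord coord_eq_iff algebra_simps)
    then show ?thesis
      by (metis coord_closed inv_solve_left m_assoc m_closed inv_closed)
  qed
  then show ?thesis
    using subgroup_conj_class_conj[of "E i True" "E q False"] by (simp add: q)
qed

lemma generate_odd_twisted_pow:
  assumes "odd m"
  shows "generate G {E i True [^] (m::int)} = generate G {E i True}"
  using twisted_pow_invertible[OF assms, of i]
    generate_subset_iff_power[of "E i True" "E i True [^] m"]
    generate_subset_iff_power[of "E i True [^] m" "E i True"]
  by (metis coord_closed int_pow_closed subset_antisym)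

text \<open>
  Write \<open>i = 2^k m\<close> with \<open>m\<close> odd.  The \<open>m\<close>-th power of \<open>y^(2^k) t\<close> agrees with \<open>y^i t\<close> modulo
  \<open>2^\<beta>\<close>, so it generates a conjugate subgroup.  The multiples of \<open>2^\<beta>\<close>, including \<open>i = 0\<close>, form the
  single case \<open>k = \<beta>\<close>.
\<close>

lemma twisted_class_representative:
  "\<exists>k\<le>\<beta>. subgroup_conj_class G (generate G {E i True}) =
    subgroup_conj_class G (generate G {E (2 ^ k) True})"
proof (cases "2 ^ \<beta> dvd i")
  case True
  then have "2 ^ \<beta> dvd i - 2 ^ \<beta>"
    by simp
  then show ?thesis
    using same_class_of_cong by blast
next
  case False
  then have "i \<noteq> 0" by auto
  then obtain k m where m: "i = 2 ^ k * m" "odd m"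
    by (rule multiplicity_decompose'[of i 2]) auto
  have "k \<le> \<beta>"
    using False m(1) by (metis dvd_mult2 le_imp_power_dvd linear)
  obtain l where l: "m = 2 * l + 1"
    using m(2) by (auto elim: oddE)
  have "subgroup_conj_class G (generate G {E (2 ^ k) True}) =
      subgroup_conj_class G (generate G {E (2 ^ k * m + 2 ^ \<beta> * (2 ^ k * l)) True})"
    using generate_odd_twisted_pow[OF m(2), of "2 ^ k"] unfolding l twisted_odd_pow by simp
  also have "\<dots> = subgroup_conj_class G (generate G {E i True})"
    by (rule same_class_of_cong) (simp add: m(1))
  finally show ?thesis
    using \<open>k \<le> \<beta>\<close> by auto
qed

text \<open>
  Modulo \<open>2^\<beta>\<close>, conjugates of powers of \<open>y^(2^k) t\<close> have a multiple of \<open>2^k\<close> as first coordinate, and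
  \<open>2^k\<close> divides the modulus.  Applied in both directions this separates the classes.
\<close>

lemma exponent_le_of_same_class:
  assumes "subgroup_conj_class G (generate G {E (2 ^ k) True}) =
      subgroup_conj_class G (generate G {E (2 ^ k') True})"
    and "k \<le> \<beta>"
  shows "k \<le> k'"
proof -
  obtain g m where g: "g \<in> carrier G"
    and pow: "E (2 ^ k') True = (inv g \<otimes> E (2 ^ k) True \<otimes> g) [^] (m::int)"
    using power_conj_of_same_class[OF _ _ assms(1)] by auto
  obtain i where i: "inv g \<otimes> E (2 ^ k) True \<otimes> g = E i True" "2 ^ \<beta> dvd i - 2 ^ k"
    using conj_coord[OF g] by blast
  obtain l where "2 * 2 ^ \<beta> dvd 2 ^ k' - (i * m + 2 ^ \<beta> * (i * l))"
    using odd_of_twisted_pow pow i(1) by metis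
  then have "2 ^ \<beta> dvd 2 ^ k' - (i * m + 2 ^ \<beta> * (i * l))"
    using dvd_mult_right by blast
  moreover have n: "(2::int) ^ k dvd 2 ^ \<beta>"
    using assms(2) by (simp add: le_imp_power_dvd)
  ultimately have d: "2 ^ k dvd 2 ^ k' - (i * m + 2 ^ \<beta> * (i * l))"
    using dvd_trans by blast
  have "2 ^ k dvd i"
    using dvd_trans[OF n i(2)] by (metis dvd_diff_right_iff dvd_refl dvd_diff_commute)
  then have "2 ^ k dvd i * m + 2 ^ \<beta> * (i * l)"
    by simp
  then have "(2::int) ^ k dvd 2 ^ k'"
    using d by (metis dvd_diff_left_iff)
  then show ?thesis
    by (simp add: dvd_power_iff)
qed

lemma untwisted_class_neq_twisted_class:
  "subgroup_conj_class G (generate G {E 1 False}) \<noteq>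
    subgroup_conj_class G (generate G {E i True})"
proof
  assume "subgroup_conj_class G (generate G {E 1 False}) =
    subgroup_conj_class G (generate G {E i True})"
  then obtain g m where g: "g \<in> carrier G"
    and pow: "E i True = (inv g \<otimes> E 1 False \<otimes> g) [^] (m::int)"
    using power_conj_of_same_class[of "E 1 False" "E i True"] by auto
  obtain j where "inv g \<otimes> E 1 False \<otimes> g = E j False"
    using conj_coord[OF g] by blast
  then show False
    using pow by (simp add: untwisted_pow coord_eq_iff)
qed

theorem eta_twisted_coordinates: "eta G = \<beta> + 2"
proof -
  define untw where "untw = subgroup_conj_class G (generate G {E 1 False})"
  define tw where "tw k = subgroup_conj_class G (generate G {E (2 ^ k) True})" for k :: nat
  have "subgroup_conj_class G ` {C. maximal_cyclic_subgroup G C} = insert untw (tw ` {..\<beta>})"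
    (is "?L = ?R")
  proof
    show "?L \<subseteq> ?R"
    proof
      fix D assume "D \<in> ?L"
      then obtain C where C: "maximal_cyclic_subgroup G C" "D = subgroup_conj_class G C"
        by auto
      from maximal_cyclic_cases[OF C(1)] show "D \<in> ?R"
      proof
        assume "C = generate G {E 1 False}"
        then show ?thesis
          by (simp add: C(2) untw_def)
      next
        assume "\<exists>i. C = generate G {E i True}"
        then obtain i where "C = generate G {E i True}"
          by blast
        then obtain k where "k \<le> \<beta>" "D = tw k"
          using twisted_class_representative[of i, folded tw_def] C(2) by blast
        then show ?thesis
          by simp
      qed
    qed
    have "untw \<in> ?L" "tw k \<in> ?L" for k
      unfolding untw_def tw_def
      by (intro imageI CollectI maximal_cyclic_untwisted maximal_cyclic_twisted)+
    then show "?R \<subseteq> ?L"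
      by blast
  qed
  moreover have "untw \<notin> tw ` {..\<beta>}"
    using untwisted_class_neq_twisted_class[of "2 ^ k" for k, folded untw_def tw_def] by blast
  moreover have "inj_on tw {..\<beta>}"
    using exponent_le_of_same_class[folded tw_def] by (intro inj_onI le_antisym) auto
  ultimately have "card ?L = Suc (card {..\<beta>})"
    by (simp only: card_insert_disjoint finite_imageI finite_atMost card_image not_False_eq_True)
  then show ?thesis
    by (simp only: eta_def card_atMost)
qed

end

text \<open>
  A group isomorphic to one with coordinates inherits them, so \<open>\<eta>\<close> can be computed directly in the
  given copy of the group.
\<close>

lemma twisted_coordinates_transport:
  assumes tc: "twisted_coordinates H E \<beta>" and G: "group G" and h: "h \<in> iso H G"
  shows "twisted_coordinates G (\<lambda>i a. h (E i a)) \<beta>"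
proof -
  interpret twisted_coordinates H E \<beta> by (rule tc)
  have inj: "inj_on h (carrier H)" and im: "h ` carrier H = carrier G"
    and hom: "h \<in> hom H G"
    using h by (auto simp: iso_def bij_betw_def)
  show ?thesis
  proof (intro twisted_coordinates.intro twisted_coordinates_axioms.intro G)
    show "carrier G = {h (E i a) | i a. True}"
      unfolding im[symmetric] carrier_coord by auto
    show "h (E i a) \<otimes>\<^bsub>G\<^esub> h (E j b) =
        h (E (i + (if a then (1 + 2 ^ \<beta>) * j else j)) (a \<noteq> b))" for i a j b
      by (simp only: hom_mult[OF hom coord_closed coord_closed, symmetric] mult_coord)
    show "h (E i a) = h (E j b) \<longleftrightarrow> a = b \<and> 2 * 2 ^ \<beta> dvd i - j" for i a j b
      using inj_on_eq_iff[OF inj] by (simp add: coord_eq_iff)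
  qed (rule beta_pos)
qed


section \<open>Coordinates in a group satisfying the relations\<close>

context group
begin

text \<open>
  The involution is \<open>t = y^(-n/2) x\<close> with \<open>n = 2^\<beta>\<close>: as \<open>n/2\<close> is even, \<open>y^(n/2)\<close> commutes with
  \<open>x\<close>, and \<open>t\<^sup>2 = y^(-n) x\<^sup>2 = 1\<close>.  The relations give the product rule and periodicity of the
  coordinates; that different coordinates give different elements cannot follow from relations
  alone, since they also hold in every quotient.
\<close>

lemma coordinates_of_relations:
  fixes \<beta> :: nat
  assumes x: "x \<in> carrier G" and y: "y \<in> carrier G" and beta: "\<beta> \<ge> 2"
    and x4: "x [^] (4::nat) = \<one>"
    and yx: "y [^] (2 ^ \<beta> :: nat) = x [^] (2::nat)"
    and conj: "inv y \<otimes> x \<otimes> y = x [^] (3::nat)"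
    and t_def: "t = y [^] (- (2 ^ (\<beta> - 1)) :: int) \<otimes> x"
    and E_def: "E = (\<lambda>(i::int) a. y [^] i \<otimes> (if a then t else \<one>))"
  shows "E i a \<otimes> E j b = E (i + (if a then (1 + 2 ^ \<beta>) * j else j)) (a \<noteq> b)"
    and "2 * 2 ^ \<beta> dvd i - j \<Longrightarrow> E i a = E j a"
    and "x = E (2 ^ (\<beta> - 1)) True"
proof -
  let ?n = "2 ^ \<beta> :: int" and ?h = "2 ^ (\<beta> - 1) :: int"
  have t: "t \<in> carrier G"
    using x y by (simp add: t_def)
  have xx: "x \<otimes> x = y [^] ?n"
    using yx x int_pow_int[of G y "2 ^ \<beta>"] by (simp add: numeral_2_eq_2)
  have period: "y [^] (2 * ?n * q) = \<one>" for q
  proof -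
    have "y [^] (2 * ?n) = y [^] ?n \<otimes> y [^] ?n"
      using y int_pow_mult[of y ?n ?n] by simp
    also have "\<dots> = x [^] (4::nat)"
      using x by (simp add: xx[symmetric] numeral_eq_Suc m_assoc)
    finally show ?thesis
      using y x4 by (simp flip: int_pow_pow)
  qed
  have periodic: "y [^] i = y [^] j" if dvd: "2 * ?n dvd i - j" for i j
  proof -
    obtain q where "i - j = 2 * ?n * q"
      using dvd by (rule dvdE)
    then have "i = j + 2 * ?n * q"
      by simp
    then show ?thesis
      using y period[of q] by (simp add: int_pow_mult)
  qed
  have "x \<otimes> y = y \<otimes> (inv y \<otimes> x \<otimes> y)"
    using x y by (simp add: m_assoc[symmetric])
  also have "\<dots> = y \<otimes> (x \<otimes> x \<otimes> x)"
    using x by (simp add: conj numeral_eq_Suc)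
  also have "\<dots> = y [^] (1 + ?n) \<otimes> x"
    using x y by (simp add: xx int_pow_mult m_assoc)
  finally have xy: "x \<otimes> y = y [^] (1 + ?n) \<otimes> x" .
  have xyj: "x \<otimes> y [^] k = y [^] ((1 + ?n) * k) \<otimes> x" for k
    by (rule commute_int_pow[OF y x xy])
  have "t \<otimes> y = y [^] (- ?h) \<otimes> (y [^] (1 + ?n) \<otimes> x)"
    using x y by (simp add: t_def m_assoc flip: xy)
  also have "\<dots> = y [^] (- ?h + (1 + ?n)) \<otimes> x"
    using x y by (simp only: int_pow_mult[of y "- ?h"] m_assoc int_pow_closed)
  also have "\<dots> = y [^] (1 + ?n + - ?h) \<otimes> x"
    by (simp only: add.commute)
  also have "\<dots> = y [^] (1 + ?n) \<otimes> t"
    using x y by (simp only: t_def int_pow_mult[of y "1 + ?n" "- ?h"] m_assoc int_pow_closed)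
  finally have ty: "t \<otimes> y = y [^] (1 + ?n) \<otimes> t" .
  have tyj: "t \<otimes> y [^] k = y [^] ((1 + ?n) * k) \<otimes> t" for k
    by (rule commute_int_pow[OF y t ty])
  obtain c where c: "\<beta> = Suc (Suc c)"
    using beta by (metis Suc_le_D numeral_2_eq_2 Suc_le_mono)
  have "t \<otimes> t = y [^] (- ?h) \<otimes> (x \<otimes> y [^] (- ?h)) \<otimes> x"
    using x y by (simp add: t_def m_assoc)
  also have "\<dots> = y [^] (- ?h) \<otimes> (y [^] ((1 + ?n) * - ?h) \<otimes> (x \<otimes> x))"
    using x y by (simp only: xyj m_assoc int_pow_closed m_closed)
  also have "\<dots> = y [^] (- ?h + ((1 + ?n) * - ?h + ?n))"
    using y by (simp only: xx int_pow_mult[OF y])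
  \<comment> \<open>The exponent is \<open>- n h\<close> with \<open>h = n/2\<close> even, a multiple of the order \<open>2n\<close> of \<open>y\<close>.\<close>
  also have "- ?h + ((1 + ?n) * - ?h + ?n) = 2 * ?n * - (2 ^ c)"
    by (simp add: c algebra_simps)
  finally have tt: "t \<otimes> t = \<one>"
    by (simp only: period)
  show "E i a \<otimes> E j b = E (i + (if a then (1 + 2 ^ \<beta>) * j else j)) (a \<noteq> b)"
  proof -
    have comm: "(if a then t else \<one>) \<otimes> y [^] j =
        y [^] (if a then (1 + ?n) * j else j) \<otimes> (if a then t else \<one>)"
      using y by (simp add: tyj)
    have tab: "(if a then t else \<one>) \<otimes> (if b then t else \<one>) = (if a \<noteq> b then t else \<one>)"
      using t tt by simp
    let ?ta = "if a then t else \<one>" and ?tb = "if b then t else \<one>"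
    have [simp]: "?ta \<in> carrier G" "?tb \<in> carrier G"
      using t by simp_all
    have "E i a \<otimes> E j b = y [^] i \<otimes> (?ta \<otimes> y [^] j) \<otimes> ?tb"
      unfolding E_def using y by (simp only: m_assoc int_pow_closed m_closed \<open>?ta \<in> carrier G\<close> \<open>?tb \<in> carrier G\<close>)
    also have "\<dots> = (y [^] i \<otimes> y [^] (if a then (1 + ?n) * j else j)) \<otimes> (?ta \<otimes> ?tb)"
      unfolding comm using y by (simp only: m_assoc int_pow_closed m_closed \<open>?ta \<in> carrier G\<close> \<open>?tb \<in> carrier G\<close>)
    also have "\<dots> = E (i + (if a then (1 + 2 ^ \<beta>) * j else j)) (a \<noteq> b)"
      unfolding tab E_def by (simp only: int_pow_mult[OF y])
    finally show ?thesis .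
  qed
  show "E i a = E j a" if "2 * 2 ^ \<beta> dvd i - j"
    unfolding E_def using periodic[OF that] by simp
  have "y [^] ?h \<otimes> (y [^] (- ?h) \<otimes> x) = x"
    using x y by (simp add: m_assoc[symmetric] flip: int_pow_mult)
  then show "x = E (2 ^ (\<beta> - 1)) True"
    by (simp add: E_def t_def)
qed

end


section \<open>Evaluation of words\<close>

text \<open>
  The effect on \<open>(i, a)\<close> of multiplying \<open>y^i t^a\<close> on the right by a letter.  For \<open>x = y^(n/2) t\<close> this adds
  \<open>n/2\<close> for both values of \<open>a\<close>, since \<open>y^(n/2)\<close> commutes with \<open>t\<close>.  For \<open>y\<close> it adds \<open>1\<close> or \<open>1 + n\<close>.
  An inverse letter (\<open>s = True\<close>) acts by the inverse bijection, so cancellation holds exactly; the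
  three relations hold only modulo \<open>2n\<close>.
\<close>

fun letter_act :: "nat \<Rightarrow> bool \<times> gen \<Rightarrow> int \<times> bool \<Rightarrow> int \<times> bool" where
  "letter_act \<beta> (s, gen_x) (i, a) = (i + (if s then - 1 else 1) * 2 ^ (\<beta> - 1), \<not> a)"
| "letter_act \<beta> (s, gen_y) (i, a) =
    (i + (if s then - 1 else 1) * (if a then 1 + 2 ^ \<beta> else 1), a)"

definition word_act :: "nat \<Rightarrow> gen gword \<Rightarrow> int \<times> bool \<Rightarrow> int \<times> bool" where
  "word_act \<beta> = fold (letter_act \<beta>)"

definition coord_cong :: "nat \<Rightarrow> int \<times> bool \<Rightarrow> int \<times> bool \<Rightarrow> bool" where
  "coord_cong \<beta> p q \<longleftrightarrow> snd p = snd q \<and> 2 * 2 ^ \<beta> dvd fst p - fst q"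

lemma word_act_append: "word_act \<beta> (u @ v) p = word_act \<beta> v (word_act \<beta> u p)"
  by (simp add: word_act_def)

lemma coord_cong_refl: "coord_cong \<beta> p p"
  by (simp add: coord_cong_def)

lemma coord_cong_sym: "coord_cong \<beta> p q \<Longrightarrow> coord_cong \<beta> q p"
  by (auto simp: coord_cong_def dvd_diff_commute)

lemma coord_cong_trans: "coord_cong \<beta> p q \<Longrightarrow> coord_cong \<beta> q r \<Longrightarrow> coord_cong \<beta> p r"
  unfolding coord_cong_def using dvd_add[of _ "fst p - fst q" "fst q - fst r"] by simp

lemma letter_act_cong: "coord_cong \<beta> p q \<Longrightarrow> coord_cong \<beta> (letter_act \<beta> l p) (letter_act \<beta> l q)"
  by (cases p; cases q; cases l; cases "snd l") (auto simp: coord_cong_def)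

lemma word_act_cong: "coord_cong \<beta> p q \<Longrightarrow> coord_cong \<beta> (word_act \<beta> w p) (word_act \<beta> w q)"
  unfolding word_act_def by (induction w arbitrary: p q) (simp_all add: letter_act_cong)

lemma letter_act_cancel: "letter_act \<beta> (\<not> s, c) (letter_act \<beta> (s, c) p) = p"
  by (cases p; cases c) auto

lemma word_act_pow_y:
  "word_act \<beta> (gw_pow (gw gen_y) m) (i, a) = (i + int m * (if a then 1 + 2 ^ \<beta> else 1), a)"
  by (induction m arbitrary: i) (auto simp: word_act_def gw_pow_def gw_def algebra_simps)

lemma word_act_relation:
  assumes "(l, r) \<in> G2_neg_rels 2 \<beta> 1 0" and "\<beta> \<ge> 2"
  shows "coord_cong \<beta> (word_act \<beta> l p) (word_act \<beta> r p)"
proof -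
  obtain b where b: "\<beta> = Suc (Suc b)"
    using assms(2) by (metis Suc_le_D numeral_2_eq_2 Suc_le_mono)
  obtain i a where p: "p = (i, a)" by (cases p)
  show ?thesis
    using assms(1) unfolding G2_neg_rels_def p
  proof (elim insertE emptyE; clarify)
    show "coord_cong \<beta> (word_act \<beta> (gw_pow (gw gen_x) (2 ^ 2)) (i, a)) (word_act \<beta> [] (i, a))"
      by (simp add: word_act_def gw_pow_def gw_def coord_cong_def b numeral_eq_Suc algebra_simps)
    show "coord_cong \<beta> (word_act \<beta> (gw_pow (gw gen_y) (2 ^ \<beta>)) (i, a))
        (word_act \<beta> (gw_pow (gw gen_x) (2 ^ (2 - 1))) (i, a))"
      unfolding word_act_pow_y
      by (simp add: word_act_def gw_pow_def gw_def coord_cong_def b numeral_eq_Suc algebra_simps)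
    show "coord_cong \<beta> (word_act \<beta> (gw_inv (gw gen_y) @ gw gen_x @ gw gen_y) (i, a))
        (word_act \<beta> (gw_pow (gw gen_x) (2 ^ (2 - 0) - 1)) (i, a))"
      by (simp add: word_act_def gw_inv_def gw_pow_def gw_def coord_cong_def b numeral_eq_Suc algebra_simps)
  qed
qed

text \<open>
  Words that are equal in the presented group act alike modulo \<open>2^(\<beta>+1)\<close>.  This is the lower bound on
  the size of the group.
\<close>

lemma word_act_invariant:
  assumes "pres_eq (G2_neg_rels 2 \<beta> 1 0) u v" and "\<beta> \<ge> 2"
  shows "coord_cong \<beta> (word_act \<beta> u p) (word_act \<beta> v p)"
  using assms(1)
proof (induction arbitrary: p rule: pres_eq.induct)
  case (refl w)
  show ?case by (rule coord_cong_refl)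
next
  case (sym v w)
  show ?case by (rule coord_cong_sym[OF sym.IH])
next
  case (trans u v w)
  show ?case by (rule coord_cong_trans[OF trans.IH])
next
  case (cancel u s a v)
  show ?case
    using letter_act_cancel[of \<beta> s a] coord_cong_refl by (simp add: word_act_def)
next
  case (rel l r u v)
  show ?case
    unfolding word_act_append by (rule word_act_cong[OF word_act_relation[OF rel assms(2)]])
qed


section \<open>Coordinates in the presented group\<close>

lemma presented_group_pow:
  "(pres_rel R `` {w}) [^]\<^bsub>presented_group R\<^esub> (m::nat) = pres_rel R `` {gw_pow w m}"
proof -
  interpret group "presented_group R" by (rule group_presented_group)
  have "gw_pow w (Suc m) = gw_pow w m @ w" for m
    by (induction m) (simp_all add: gw_pow_def)
  moreover have "\<one>\<^bsub>presented_group R\<^esub> = pres_rel R `` {[]}"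
    by (simp add: presented_group_def)
  ultimately show ?thesis
    by (induction m) (simp_all add: presented_group_mult, simp add: gw_pow_def)
qed

lemma presented_group_class_closed: "pres_rel R `` {w} \<in> carrier (presented_group R)"
  by (auto simp: presented_group_def quotient_def)

lemma presented_group_inv:
  "inv\<^bsub>presented_group R\<^esub> (pres_rel R `` {w}) = pres_rel R `` {gw_inv w}"
proof -
  interpret group "presented_group R" by (rule group_presented_group)
  have "pres_rel R `` {gw_inv w @ w} = pres_rel R `` {[]}"
    by (rule equiv_class_eq[OF equiv_pres_rel]) (simp add: pres_rel_def pres_eq_inv)
  then show ?thesis
    by (intro inv_equality presented_group_class_closed)
      (simp_all add: presented_group_mult, simp add: presented_group_def)
qed

lemma presented_group_relation:
  assumes "(l, r) \<in> R"
  shows "pres_rel R `` {l} = pres_rel R `` {r}"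
  using pres_eq.rel[OF assms, of "[]" "[]"]
  by (intro equiv_class_eq[OF equiv_pres_rel]) (simp add: pres_rel_def)

text \<open>
  A word for \<open>y^i\<close> that moves \<open>(0, False)\<close> to \<open>(i, False)\<close>, so that the action can be compared with the
  coordinates.
\<close>

lemma power_y_word:
  obtains w where "(pres_rel R `` {gw gen_y}) [^]\<^bsub>presented_group R\<^esub> (i::int) = pres_rel R `` {w}"
    "word_act \<beta> w (0, False) = (i, False)"
proof (cases "i \<ge> 0")
  case True
  show thesis
  proof (rule that)
    show "(pres_rel R `` {gw gen_y}) [^]\<^bsub>presented_group R\<^esub> i = pres_rel R `` {gw_pow (gw gen_y) (nat i)}"
      using True by (simp add: int_pow_def2 presented_group_pow)
    show "word_act \<beta> (gw_pow (gw gen_y) (nat i)) (0, False) = (i, False)"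
      using True by (simp add: word_act_pow_y)
  qed
next
  case False
  have inv_pow: "word_act \<beta> (gw_inv (gw_pow (gw gen_y) m)) (j, False) = (j - int m, False)" for m j
    by (induction m arbitrary: j) (auto simp: word_act_def gw_pow_def gw_def gw_inv_def)
  show thesis
  proof (rule that)
    show "(pres_rel R `` {gw gen_y}) [^]\<^bsub>presented_group R\<^esub> i =
        pres_rel R `` {gw_inv (gw_pow (gw gen_y) (nat (- i)))}"
      using False by (simp add: int_pow_def2 presented_group_pow presented_group_inv)
    show "word_act \<beta> (gw_inv (gw_pow (gw gen_y) (nat (- i)))) (0, False) = (i, False)"
      using False by (simp add: inv_pow)
  qed
qed

text \<open>
  The relations supply all coordinate laws but injectivity.  For the latter, \<open>y^i t^a\<close> has a word that
  moves \<open>(0, False)\<close> to \<open>(i, a)\<close>; equal elements have words that act alike, so their coordinates agree.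
\<close>

lemma G2_neg_twisted_coordinates:
  assumes beta: "\<beta> \<ge> 2"
  shows "\<exists>E. twisted_coordinates (G2_neg 2 \<beta> 1 0) E \<beta>"
proof -
  define R where "R = G2_neg_rels 2 \<beta> 1 0"
  let ?P = "presented_group R"
  define x where "x = pres_rel R `` {gw gen_x}"
  define y where "y = pres_rel R `` {gw gen_y}"
  interpret group ?P by (rule group_presented_group)
  have x: "x \<in> carrier ?P" and y: "y \<in> carrier ?P"
    by (simp_all add: x_def y_def presented_group_class_closed)
  have one: "\<one>\<^bsub>?P\<^esub> = pres_rel R `` {[]}"
    by (simp add: presented_group_def)
  have x4: "x [^]\<^bsub>?P\<^esub> (4::nat) = \<one>\<^bsub>?P\<^esub>"
    unfolding x_def presented_group_pow one
    by (rule presented_group_relation) (simp add: R_def G2_neg_rels_def)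
  have yx: "y [^]\<^bsub>?P\<^esub> (2 ^ \<beta> :: nat) = x [^]\<^bsub>?P\<^esub> (2::nat)"
    unfolding x_def y_def presented_group_pow
    by (rule presented_group_relation) (simp add: R_def G2_neg_rels_def)
  have conj: "inv\<^bsub>?P\<^esub> y \<otimes>\<^bsub>?P\<^esub> x \<otimes>\<^bsub>?P\<^esub> y = x [^]\<^bsub>?P\<^esub> (3::nat)"
    unfolding x_def y_def presented_group_pow presented_group_inv presented_group_mult
    by (rule presented_group_relation) (simp add: R_def G2_neg_rels_def)
  let ?h = "2 ^ (\<beta> - 1) :: int"
  define t where "t = y [^]\<^bsub>?P\<^esub> (- ?h) \<otimes>\<^bsub>?P\<^esub> x"
  define E where "E = (\<lambda>(i::int) a. y [^]\<^bsub>?P\<^esub> i \<otimes>\<^bsub>?P\<^esub> (if a then t else \<one>\<^bsub>?P\<^esub>))"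
  note coords = coordinates_of_relations[OF x y beta x4 yx conj t_def E_def]
  have E_closed: "E i a \<in> carrier ?P" for i a
    using x y by (simp add: E_def t_def)
  have yE: "y = E 1 False"
    using y by (simp add: E_def)
  have E_word: "\<exists>w. E i a = pres_rel R `` {w} \<and> word_act \<beta> w (0, False) = (i, a)" for i a
  proof (cases a)
    case False
    obtain w where "y [^]\<^bsub>?P\<^esub> i = pres_rel R `` {w}" "word_act \<beta> w (0, False) = (i, False)"
      unfolding y_def by (rule power_y_word)
    moreover have "E i a = y [^]\<^bsub>?P\<^esub> i"
      using False y by (simp add: E_def)
    ultimately show ?thesis
      using False by auto
  next
    case True
    obtain w where w: "y [^]\<^bsub>?P\<^esub> (i - ?h) = pres_rel R `` {w}"
      "word_act \<beta> w (0, False) = (i - ?h, False)"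
      unfolding y_def by (rule power_y_word)
    have "E i a = y [^]\<^bsub>?P\<^esub> (i - ?h) \<otimes>\<^bsub>?P\<^esub> x"
      using True x y int_pow_mult[OF y, of i "- ?h"] by (simp add: E_def t_def m_assoc)
    then have "E i a = pres_rel R `` {w @ gw gen_x}"
      by (simp only: w(1) x_def presented_group_mult)
    moreover have "word_act \<beta> (w @ gw gen_x) (0, False) = (i, a)"
      using True by (simp add: word_act_append w(2)) (simp add: word_act_def gw_def)
    ultimately show ?thesis by blast
  qed
  have range: "pres_rel R `` {w} \<in> {E i a | i a. True}" for w
  proof (induction w rule: rev_induct)
    case Nil
    have "\<one>\<^bsub>?P\<^esub> = E 0 False"
      using y by (simp add: E_def)
    then show ?case
      using one by auto
  next
    case (snoc l w)
    have mult: "g \<otimes>\<^bsub>?P\<^esub> g' \<in> {E i a | i a. True}"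
      if "g \<in> {E i a | i a. True}" "g' \<in> {E i a | i a. True}" for g g'
      using that coords(1) by blast
    have letter: "pres_rel R `` {[l]} \<in> {E i a | i a. True}"
    proof -
      obtain s c where l: "l = (s, c)" by (cases l)
      have inv_letter: "pres_rel R `` {[(True, c)]} = inv\<^bsub>?P\<^esub> (pres_rel R `` {gw c})" for c
        by (simp add: presented_group_inv gw_inv_def gw_def)
      have "inv\<^bsub>?P\<^esub> y = E (- 1) False"
        using y by (simp add: E_def int_pow_neg)
      \<comment> \<open>Since \<open>x^4 = 1\<close>, the inverse of \<open>x\<close> is a product of elements already covered.\<close>
      moreover have "inv\<^bsub>?P\<^esub> x = x \<otimes>\<^bsub>?P\<^esub> x \<otimes>\<^bsub>?P\<^esub> x"
        using x x4 by (intro inv_equality) (simp_all add: numeral_eq_Suc)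
      moreover have "x \<in> {E i a | i a. True}"
        using coords(3) by blast
      ultimately have "inv\<^bsub>?P\<^esub> y \<in> {E i a | i a. True}" "inv\<^bsub>?P\<^esub> x \<in> {E i a | i a. True}"
        "x \<in> {E i a | i a. True}" "y \<in> {E i a | i a. True}"
        using mult yE by (blast, metis (no_types, lifting), blast, blast)
      then show ?thesis
        by (cases s; cases c) (simp_all add: l inv_letter flip: x_def y_def,
            simp_all add: x_def y_def gw_def)
    qed
    show ?case
      using mult[OF snoc letter] by (simp add: presented_group_mult)
  qed
  have "twisted_coordinates ?P E \<beta>"
  proof (intro twisted_coordinates.intro twisted_coordinates_axioms.intro is_group)
    show "\<beta> > 0" using beta by simp
    have "carrier ?P \<subseteq> {E i a | i a. True}"
      using range by (auto simp: presented_group_def quotient_def)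
    then show "carrier ?P = {E i a | i a. True}"
      using E_closed by auto
    show "E i a \<otimes>\<^bsub>?P\<^esub> E j b = E (i + (if a then (1 + 2 ^ \<beta>) * j else j)) (a \<noteq> b)" for i a j b
      by (rule coords(1))
    show "E i a = E j b \<longleftrightarrow> a = b \<and> 2 * 2 ^ \<beta> dvd i - j" for i a j b
    proof
      assume eq: "E i a = E j b"
      obtain u v where u: "E i a = pres_rel R `` {u}" "word_act \<beta> u (0, False) = (i, a)"
        and v: "E j b = pres_rel R `` {v}" "word_act \<beta> v (0, False) = (j, b)"
        using E_word by meson
      have "pres_eq R u v"
        using eq eq_equiv_class[OF _ equiv_pres_rel, of R u v] u(1) v(1)
        by (simp add: pres_rel_def)
      then have "coord_cong \<beta> (i, a) (j, b)"
        using word_act_invariant[OF _ beta, folded R_def, of u v "(0, False)"] u(2) v(2) by simp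
      then show "a = b \<and> 2 * 2 ^ \<beta> dvd i - j"
        by (simp add: coord_cong_def)
    next
      assume "a = b \<and> 2 * 2 ^ \<beta> dvd i - j"
      then show "E i a = E j b"
        using coords(2) by blast
    qed
  qed
  then show ?thesis
    by (auto simp: G2_neg_def R_def)
qed

theorem lemma4p7:
  fixes G :: "('a, 'b) monoid_scheme" and \<beta> :: nat
  assumes "group G"
    and "G \<cong> G2_neg 2 \<beta> 1 0"
    and "\<beta> \<ge> 3"
  shows "eta G = \<beta> + 2"
proof -
  have "\<beta> \<ge> 2"
    using assms(3) by simp
  then obtain E where "twisted_coordinates (G2_neg 2 \<beta> 1 0) E \<beta>"
    using G2_neg_twisted_coordinates by blast
  moreover obtain h where "h \<in> iso (G2_neg 2 \<beta> 1 0) G"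
    using group.iso_sym[OF assms(1,2)] by (auto simp: is_iso_def)
  ultimately have "twisted_coordinates G (\<lambda>i a. h (E i a)) \<beta>"
    using twisted_coordinates_transport assms(1) by blast
  then show ?thesis
    by (rule twisted_coordinates.eta_twisted_coordinates)
qed

end
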